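(* For $n\ge 3$, let $J_n^-$ and $J_n^+$ be the minimum and maximum of the function $\mathrm{JB}_n$ over the sphere $\Omega_n$. Then $$J_n^+=\frac{n}{24}\bigl(A_n^4+4\bigr)=\frac{n\{(n-2)^4+4(n-1)^2\}}{24(n-1)^2},\qquad A_n=\frac{n-2}{\sqrt{n-1}},$$ and this maximum is attained at the single-outlier directions, i.e. at $u=\pm\{n(n-1)\}^{-1/2}(n-1,-1,\dots,-1)'$ and their coordinate permutations. Further, $J_3^-=9/32$, $J_4^-=1/6$, $J_5^-=5/96$, and $J_n^-=0$ for every $n\ge 6$.
   Context: For $u\in\mathbb{R}^n$ write $p_r(u)=\sum_{i=1}^n u_i^r$. $\Omega_n=\{u\in\mathbb{R}^n:\ p_1(u)=0,\ p_2(u)=1\}$ is the unit sphere (of dimension $n-2$) in the hyperplane $\{\sum_i u_i=0\}$. For $u\in\Omega_n$ put $S=\sqrt n\,p_3(u)$, $K=n\,p_4(u)$, and define $$\mathrm{JB}_n(u)=\frac n6\Bigl\{S^2+\tfrac14(K-3)^2\Bigr\}=\frac{n^2}{6}p_3(u)^2+\frac{n}{24}\bigl(n p_4(u)-3\bigr)^2 .$$ *)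

theory Defs
  imports Complex_Main "HOL-Library.FuncSet" "HOL-Combinatorics.Permutations"
begin

text \<open>
  Vectors of \<open>\<real>\<^sup>n\<close> are functions on the index set \<open>{1..n}\<close>, normalised to be
  \<open>undefined\<close> elsewhere (\<^const>\<open>extensional\<close>), so that \<open>n\<close> can be quantified over.
\<close>

definition power_sum :: "nat \<Rightarrow> nat \<Rightarrow> (nat \<Rightarrow> real) \<Rightarrow> real" where
  "power_sum n r u = (\<Sum>i=1..n. u i ^ r)"

definition Omega :: "nat \<Rightarrow> (nat \<Rightarrow> real) set" where
  "Omega n = {u \<in> extensional {1..n}. power_sum n 1 u = 0 \<and> power_sum n 2 u = 1}"

definition skewness :: "nat \<Rightarrow> (nat \<Rightarrow> real) \<Rightarrow> real" where
  "skewness n u = sqrt (real n) * power_sum n 3 u"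

definition kurtosis :: "nat \<Rightarrow> (nat \<Rightarrow> real) \<Rightarrow> real" where
  "kurtosis n u = real n * power_sum n 4 u"

definition JB :: "nat \<Rightarrow> (nat \<Rightarrow> real) \<Rightarrow> real" where
  "JB n u = real n / 6 * ((skewness n u)\<^sup>2 + 1 / 4 * (kurtosis n u - 3)\<^sup>2)"

lemma JB_power_sum:
  "JB n u = (real n)\<^sup>2 / 6 * (power_sum n 3 u)\<^sup>2
     + real n / 24 * (real n * power_sum n 4 u - 3)\<^sup>2"
  by (simp add: JB_def skewness_def kurtosis_def power_mult_distrib power2_eq_square algebra_simps)

text \<open>
  Minimum and maximum of the set of values. These are meaningful only if the extremum is
  attained, which therefore has to be asserted separately.
\<close>

definition J_minus :: "nat \<Rightarrow> real" where
  "J_minus n = (LEAST y. y \<in> JB n ` Omega n)"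

definition J_plus :: "nat \<Rightarrow> real" where
  "J_plus n = (GREATEST y. y \<in> JB n ` Omega n)"

definition A_n :: "nat \<Rightarrow> real" where
  "A_n n = (real n - 2) / sqrt (real n - 1)"

definition outlier :: "nat \<Rightarrow> nat \<Rightarrow> real" where
  "outlier n = (\<lambda>i\<in>{1..n}. (if i = 1 then real n - 1 else - 1) / sqrt (real n * (real n - 1)))"

definition single_outlier_directions :: "nat \<Rightarrow> (nat \<Rightarrow> real) set" where
  "single_outlier_directions n =
     {(\<lambda>i\<in>{1..n}. s * outlier n (\<pi> i)) | s \<pi>. s \<in> {1, - 1} \<and> \<pi> permutes {1..n}}"

end

theory Submission
  imports Defs
begin

text \<open>
  Both extrema are governed by how large the fourth power sum can be and by how it is tied
  to the third one.

  For the maximum, Pearson's inequality \<open>S\<^sup>2 + 1 \<le> K\<close> eliminates the skewness: it gives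
  \<open>JB \<le> (n / 24) ((K - 1)\<^sup>2 + 4)\<close>, which increases in \<open>K \<ge> 1\<close>. So everything reduces to the
  sharp bound \<open>K \<le> A\<^sub>n\<^sup>2 + 1\<close> (lemma \<open>kurtosis_le\<close>), and at a single-outlier direction both
  inequalities are equalities. The sharp bound is obtained by splitting off the coordinate
  of largest square \<open>q\<close>. Trivially \<open>p\<^sub>4 \<le> q\<close>, which suffices unless \<open>q\<close> is close to its
  largest possible value \<open>(n - 1) / n\<close>; in that range the other \<open>N = n - 1\<close> coordinates
  \<open>v\<close> are close to their mean \<open>-a\<close>, and \<open>\<Sum> (v\<^sup>2 - a\<^sup>2)\<^sup>2 \<le> max (v - a)\<^sup>2 \<sqdot> \<Sum> (v + a)\<^sup>2\<close>
  bounds their fourth powers by a quantity that is exact at the outlier.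

  For the minimum with \<open>n \<ge> 6\<close>, the value 0 is reached by a symmetric vector made of pairs
  \<open>\<plusminus>x\<close>, for which \<open>p\<^sub>3 = 0\<close> and \<open>K\<close> can be tuned to be 3 (lemma \<open>JB_zero_attained\<close>).

  For \<open>n \<le> 5\<close> write \<open>e\<^sub>k\<close> for the elementary symmetric functions of the coordinates. On the
  sphere \<open>p\<^sub>3 = 3 e\<^sub>3\<close> and \<open>p\<^sub>4 = 1/2 - 4 e\<^sub>4\<close>, and the third elementary symmetric
  function of the squares \<open>u\<^sub>i\<^sup>2\<close>, which is nonnegative, equals \<open>e\<^sub>3\<^sup>2 + e\<^sub>4\<close>. Hence \<open>p\<^sub>4\<close> cannot
  exceed \<open>1/2\<close>, that is, \<open>K\<close> cannot exceed \<open>n / 2 < 3\<close>, without a compensating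
  skewness, and the minimum is the value \<open>(n / 24) (n / 2 - 3)\<^sup>2\<close> taken at
  \<open>(1, -1, 0, \<dots>) / \<surd>2\<close> (lemmas \<open>JB_ge\<close> and \<open>JB_single_pair_attained\<close>).
\<close>

section \<open>Upper bounds on the moments\<close>

text \<open>
  The vector with entries \<open>u\<^sub>i\<^sup>2\<close> is projected orthogonally to \<open>u\<close> and to the all-ones
  vector; the inequality says that the residual has a nonnegative squared norm.
\<close>

lemma pearson_inequality:
  fixes u :: "'a \<Rightarrow> real"
  assumes "finite A" "A \<noteq> {}" "(\<Sum>i\<in>A. u i) = 0" "(\<Sum>i\<in>A. u i ^ 2) = 1"
  shows "1 / real (card A) + (\<Sum>i\<in>A. u i ^ 3)\<^sup>2 \<le> (\<Sum>i\<in>A. u i ^ 4)"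
proof -
  define c where "c = 1 / real (card A)"
  define p where "p = (\<Sum>i\<in>A. u i ^ 3)"
  have c: "real (card A) * c = 1"
    using assms by (simp add: c_def)
  have "0 \<le> (\<Sum>i\<in>A. (u i ^ 2 - p * u i - c)\<^sup>2)"
    by (simp add: sum_nonneg)
  also have "\<dots> = (\<Sum>i\<in>A. u i ^ 4 - 2 * p * u i ^ 3 + (p\<^sup>2 - 2 * c) * u i ^ 2 + 2 * p * c * u i + c * c)"
    by (intro sum.cong refl) (simp add: power2_eq_square power3_eq_cube power4_eq_xxxx algebra_simps)
  also have "\<dots> = (\<Sum>i\<in>A. u i ^ 4) - 2 * p * p + (p\<^sup>2 - 2 * c) + real (card A) * (c * c)"
    by (simp add: sum.distrib sum_subtractf assms p_def flip: sum_distrib_left)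
  also have "real (card A) * (c * c) = c"
    using c by (simp flip: mult.assoc)
  finally show ?thesis
    by (simp add: c_def p_def power2_eq_square)
qed

text \<open>
  Here \<open>x = 1 / N\<close>, \<open>q\<close> is the largest square and \<open>s\<close> is the sum of squared deviations of the
  other coordinates from their mean; \<open>s = 0\<close> is the single-outlier direction. The right side
  minus the left side vanishes at \<open>s = 0\<close> and is quadratic in \<open>s\<close>, so it is \<open>s / (1 + x)\<close>
  times a linear function \<open>L\<close> of \<open>s\<close>. This \<open>L\<close> is decreasing and still positive at the end
  \<open>s = x - x\<^sup>2\<close> of the range.
\<close>

lemma quartic_bound_near_outlier:
  fixes x s q :: real
  assumes x: "0 < x" "x \<le> 1 / 3" and s: "0 \<le> s" "s \<le> x - x\<^sup>2" and q: "q * (1 + x) = 1 - s"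
  shows "q\<^sup>2 + 2 * q * x\<^sup>2 * (1 - q) - q\<^sup>2 * x ^ 3 + (3 / 2 * (1 - q) + 3 * q * x\<^sup>2) * s
           \<le> (1 - x + x\<^sup>2) / (1 + x)"
proof -
  define L where "L = 2 - 7 / 2 * x - 3 * x\<^sup>2 - s * (5 / 2 - x - 4 * x\<^sup>2)"
  have x2: "x\<^sup>2 \<le> 1 / 9"
    using power_mono[of x "1 / 3" 2] x by (simp add: power2_eq_square)
  have "s * (5 / 2 - x - 4 * x\<^sup>2) \<le> (x - x\<^sup>2) * (5 / 2 - x - 4 * x\<^sup>2)"
    using s x x2 by (intro mult_right_mono) auto
  also have "\<dots> = (2 - 7 / 2 * x - 3 * x\<^sup>2) - ((2 - 6 * x) + x\<^sup>2 * (1 / 2 - 4 * x\<^sup>2) + 3 * x ^ 3)"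
    by (simp add: power2_eq_square power3_eq_cube field_simps)
  finally have "L \<ge> (2 - 6 * x) + x\<^sup>2 * (1 / 2 - 4 * x\<^sup>2) + 3 * x ^ 3"
    unfolding L_def by linarith
  moreover have "x\<^sup>2 * (1 / 2 - 4 * x\<^sup>2) \<ge> 0"
    using x2 by (intro mult_nonneg_nonneg) auto
  moreover have "0 \<le> x ^ 3" using x by simp
  ultimately have "0 \<le> L" using x by linarith
  then have "0 \<le> s * L / (1 + x)"
    using s x by simp
  also have "s * L / (1 + x) = (1 - x + x\<^sup>2) / (1 + x)
      - (q\<^sup>2 + 2 * q * x\<^sup>2 * (1 - q) - q\<^sup>2 * x ^ 3 + (3 / 2 * (1 - q) + 3 * q * x\<^sup>2) * s)"
  proof -
    have nz: "1 + x \<noteq> 0" using x by simp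
    then have qe: "q = (1 - s) / (1 + x)" using q by (simp add: field_simps)
    show ?thesis
      unfolding qe L_def using nz
      by (simp add: divide_simps) algebra
  qed
  finally show ?thesis by simp
qed

lemma centred_triple_quartic:
  fixes a b c :: real
  assumes "a + b + c = 0"
  shows "2 * (a ^ 4 + b ^ 4 + c ^ 4) = (a\<^sup>2 + b\<^sup>2 + c\<^sup>2)\<^sup>2"
  using assms by algebra

text \<open>
  The right side is \<open>(n\<^sup>2 - 3n + 3) / (n (n - 1))\<close> for \<open>n = N + 1\<close>, the fourth power sum of the
  single-outlier direction. The crude bound \<open>q\<close> and the bound that is exact
  at the outlier together cover all values of \<open>q\<close> only for \<open>N \<ge> 3\<close>; three coordinates are
  treated by \<open>centred_triple_quartic\<close>.
\<close>

lemma sum_fourth_powers_le: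
  fixes u :: "'a \<Rightarrow> real"
  assumes A: "finite A" "card A = N + 1" "N \<ge> 3"
    and s1: "(\<Sum>i\<in>A. u i) = 0" and s2: "(\<Sum>i\<in>A. u i ^ 2) = 1"
  shows "(\<Sum>i\<in>A. u i ^ 4) \<le> (1 - 1 / real N + (1 / real N)\<^sup>2) / (1 + 1 / real N)"
proof -
  define x where "x = 1 / real N"
  have x: "0 < x" "x \<le> 1 / 3" "real N * x = 1"
    using A by (auto simp: x_def field_simps)
  have "A \<noteq> {}" using A by auto
  then obtain k where k: "k \<in> A" "\<And>i. i \<in> A \<Longrightarrow> u i ^ 2 \<le> u k ^ 2"
    using Max_in[of "(\<lambda>i. u i ^ 2) ` A"] Max_ge[of "(\<lambda>i. u i ^ 2) ` A"] A(1) by fastforce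
  define q where "q = u k ^ 2"
  have "(\<Sum>i\<in>A. u i ^ 4) \<le> (\<Sum>i\<in>A. q * u i ^ 2)"
  proof (intro sum_mono)
    fix i assume "i \<in> A"
    then have "u i ^ 2 * u i ^ 2 \<le> q * u i ^ 2"
      using k(2) unfolding q_def by (intro mult_right_mono) auto
    then show "u i ^ 4 \<le> q * u i ^ 2"
      by (simp add: power2_eq_square power4_eq_xxxx)
  qed
  then have le_q: "(\<Sum>i\<in>A. u i ^ 4) \<le> q"
    by (simp add: s2 flip: sum_distrib_left)
  define I where "I = A - {k}"
  have I: "finite I" "card I = N" using A k by (auto simp: I_def)
  have split: "(\<Sum>i\<in>A. f i) = f k + (\<Sum>i\<in>I. f i)" for f :: "'a \<Rightarrow> real"
    unfolding I_def using A k by (simp add: sum.remove)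
  have t1: "(\<Sum>i\<in>I. u i) = - u k" and t2: "(\<Sum>i\<in>I. u i ^ 2) = 1 - q"
    using s1 s2 split[of u] split[of "\<lambda>i. u i ^ 2"] by (auto simp: q_def)
  \<comment> \<open>\<open>- a\<close> is the mean of the coordinates other than \<open>u k\<close>.\<close>
  define a where "a = u k * x"
  define s where "s = 1 - q * (1 + x)"
  have a2: "a\<^sup>2 = q * x\<^sup>2" by (simp add: a_def q_def power_mult_distrib)
  have "(\<Sum>i\<in>I. (u i + a)\<^sup>2) = (\<Sum>i\<in>I. u i ^ 2 + 2 * a * u i + a\<^sup>2)"
    by (simp add: power2_eq_square algebra_simps)
  also have "\<dots> = 1 - q - 2 * a * u k + real N * a\<^sup>2"
    by (simp add: sum.distrib t1 t2 I flip: sum_distrib_left)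
  also have "real N * a\<^sup>2 = q * x"
    unfolding a2 using x(3) by (simp add: power2_eq_square)
  also have "a * u k = q * x"
    by (simp add: a_def q_def power2_eq_square)
  then have "1 - q - 2 * a * u k + q * x = s"
    by (simp add: s_def algebra_simps)
  finally have r: "(\<Sum>i\<in>I. (u i + a)\<^sup>2) = s" .
  have s0: "s \<ge> 0" unfolding r[symmetric] by (simp add: sum_nonneg)
  define R where "R = 3 / 2 * (1 - q) + 3 * q * x\<^sup>2"
  have "(\<Sum>i\<in>I. (u i ^ 2 - a\<^sup>2)\<^sup>2) \<le> (\<Sum>i\<in>I. R * (u i + a)\<^sup>2)"
  proof (intro sum_mono)
    fix i assume i: "i \<in> I"
    have "u i ^ 2 \<le> 1 - q"
      unfolding t2[symmetric] using i I by (intro member_le_sum) auto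
    \<comment> \<open>The plain \<open>(v - a)\<^sup>2 \<le> 2 v\<^sup>2 + 2 a\<^sup>2\<close> would be too weak for \<open>N = 3\<close>; as \<open>a\<close> is small
        compared with the possible values of \<open>v\<close>, weight is moved from \<open>v\<^sup>2\<close> to \<open>a\<^sup>2\<close>.\<close>
    moreover have "3 * u i ^ 2 + 6 * a\<^sup>2 - 2 * (u i - a)\<^sup>2 = (u i + 2 * a)\<^sup>2"
      by algebra
    then have "0 \<le> 3 * u i ^ 2 + 6 * a\<^sup>2 - 2 * (u i - a)\<^sup>2"
      by simp
    ultimately have "(u i - a)\<^sup>2 \<le> R"
      unfolding R_def mult.assoc a2[symmetric] by argo
    then have "(u i - a)\<^sup>2 * (u i + a)\<^sup>2 \<le> R * (u i + a)\<^sup>2"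
      by (intro mult_right_mono) auto
    then show "(u i ^ 2 - a\<^sup>2)\<^sup>2 \<le> R * (u i + a)\<^sup>2"
      by (simp add: power2_eq_square algebra_simps)
  qed
  also have "\<dots> = R * s" by (simp add: r flip: sum_distrib_left)
  finally have 1: "(\<Sum>i\<in>I. (u i ^ 2 - a\<^sup>2)\<^sup>2) \<le> R * s" .
  have "(\<Sum>i\<in>I. (u i ^ 2 - a\<^sup>2)\<^sup>2) = (\<Sum>i\<in>I. u i ^ 4 - 2 * a\<^sup>2 * u i ^ 2 + a\<^sup>2 * a\<^sup>2)"
    by (intro sum.cong refl) (simp add: power2_eq_square power4_eq_xxxx algebra_simps)
  also have "\<dots> = (\<Sum>i\<in>I. u i ^ 4) - 2 * a\<^sup>2 * (1 - q) + real N * (a\<^sup>2 * a\<^sup>2)"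
    by (simp add: sum.distrib sum_subtractf t2 I flip: sum_distrib_left)
  also have "real N * (a\<^sup>2 * a\<^sup>2) = q\<^sup>2 * x ^ 3"
  proof -
    have "real N * (a\<^sup>2 * a\<^sup>2) = (real N * x) * (q\<^sup>2 * x ^ 3)"
      unfolding a2 by (simp add: power2_eq_square power3_eq_cube)
    then show ?thesis by (simp add: x)
  qed
  finally have 2: "(\<Sum>i\<in>I. u i ^ 4) \<le> 2 * q * x\<^sup>2 * (1 - q) - q\<^sup>2 * x ^ 3 + R * s"
    using 1 by (simp add: a2)
  have "u k ^ 4 = q\<^sup>2" by (simp add: q_def)
  with 2 split[of "\<lambda>i. u i ^ 4"]
  have le: "(\<Sum>i\<in>A. u i ^ 4) \<le> q\<^sup>2 + 2 * q * x\<^sup>2 * (1 - q) - q\<^sup>2 * x ^ 3 + R * s" by simp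
  show ?thesis unfolding x_def[symmetric]
  proof (cases "s \<le> x - x\<^sup>2")
    case True
    have "q * (1 + x) = 1 - s" by (simp add: s_def)
    from quartic_bound_near_outlier[OF x(1,2) s0 True this] le
    show "(\<Sum>i\<in>A. u i ^ 4) \<le> (1 - x + x\<^sup>2) / (1 + x)" unfolding R_def by linarith
  next
    case False
    then have "q \<le> (1 - x + x\<^sup>2) / (1 + x)"
      using x by (simp add: s_def pos_le_divide_eq)
    with le_q show "(\<Sum>i\<in>A. u i ^ 4) \<le> (1 - x + x\<^sup>2) / (1 + x)" by linarith
  qed
qed

lemma kurtosis_le:
  assumes n: "n \<ge> 3" and u: "u \<in> Omega n"
  shows "kurtosis n u \<le> (real n - 2)\<^sup>2 / (real n - 1) + 1"
proof (cases "n = 3")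
  case True
  have "{1..3::nat} = {1, 2, 3}" by auto
  then have "u 1 + u 2 + u 3 = 0" "u 1 ^ 2 + u 2 ^ 2 + u 3 ^ 2 = 1"
    and e: "power_sum n 4 u = u 1 ^ 4 + u 2 ^ 4 + u 3 ^ 4"
    using u True by (auto simp: Omega_def power_sum_def)
  with centred_triple_quartic[of "u 1" "u 2" "u 3"] have "power_sum n 4 u = 1 / 2"
    by (simp add: e)
  then show ?thesis using True by (simp add: kurtosis_def)
next
  case False
  define m where "m = real n - 1"
  have m: "m \<ge> 3" "real n = m + 1" "real (n - 1) = m" using n False by (auto simp: m_def)
  have "power_sum n 4 u \<le> (1 - 1 / m + (1 / m)\<^sup>2) / (1 + 1 / m)"
    using sum_fourth_powers_le[of "{1..n}" "n - 1" u] u n False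
    unfolding m(3) by (auto simp: Omega_def power_sum_def)
  then have "kurtosis n u \<le> (m + 1) * ((1 - 1 / m + (1 / m)\<^sup>2) / (1 + 1 / m))"
    using m unfolding kurtosis_def by (intro mult_mono) (auto simp: power_sum_def intro: sum_nonneg)
  also have "\<dots> = (real n - 2)\<^sup>2 / (real n - 1) + 1"
    using m(1) unfolding m(2) by (simp add: divide_simps) algebra
  finally show ?thesis .
qed

lemma kurtosis_ge:
  assumes n: "n \<ge> 1" and u: "u \<in> Omega n"
  shows "(skewness n u)\<^sup>2 + 1 \<le> kurtosis n u"
proof -
  have "1 / real n + (power_sum n 3 u)\<^sup>2 \<le> power_sum n 4 u"
    using pearson_inequality[of "{1..n}" u] assms by (auto simp: Omega_def power_sum_def)
  then have "real n * (1 / real n + (power_sum n 3 u)\<^sup>2) \<le> real n * power_sum n 4 u"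
    by (intro mult_left_mono) auto
  then show ?thesis
    using n by (simp add: skewness_def kurtosis_def power_mult_distrib distrib_left)
qed

lemma JB_le:
  assumes n: "n \<ge> 3" and u: "u \<in> Omega n"
  shows "JB n u \<le> real n / 24 * (((real n - 2)\<^sup>2 / (real n - 1))\<^sup>2 + 4)"
proof -
  define K where "K = kurtosis n u"
  have S: "(skewness n u)\<^sup>2 \<le> K - 1" using kurtosis_ge[of n u] assms by (simp add: K_def)
  then have "0 \<le> K - 1" by (smt (verit) zero_le_power2)
  moreover have "K - 1 \<le> (real n - 2)\<^sup>2 / (real n - 1)" using kurtosis_le[OF assms] by (simp add: K_def)
  ultimately have "(K - 1)\<^sup>2 \<le> ((real n - 2)\<^sup>2 / (real n - 1))\<^sup>2" by (intro power_mono)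
  moreover have "JB n u \<le> real n / 6 * ((K - 1) + 1 / 4 * (K - 3)\<^sup>2)"
    unfolding JB_def K_def[symmetric] using S by (intro mult_left_mono) auto
  moreover have "real n / 6 * ((K - 1) + 1 / 4 * (K - 3)\<^sup>2) = real n / 24 * ((K - 1)\<^sup>2 + 4)"
    by (simp add: power2_eq_square algebra_simps)
  ultimately show ?thesis
    by (smt (verit) mult_left_mono divide_nonneg_nonneg of_nat_0_le_iff)
qed

section \<open>Single-outlier directions\<close>

lemma power_sum_outlier:
  assumes n: "n \<ge> 2" and r: "r \<ge> 1"
  shows "power_sum n r (outlier n)
           = ((real n - 1) ^ r + (real n - 1) * (- 1) ^ r) / sqrt (real n * (real n - 1)) ^ r"
proof -
  have "{1..n} = insert 1 {2..n}" using n by auto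
  then have "power_sum n r (outlier n) = ((real n - 1) / sqrt (real n * (real n - 1))) ^ r
      + (\<Sum>i=2..n. (- 1 / sqrt (real n * (real n - 1))) ^ r)"
    unfolding power_sum_def by (simp add: outlier_def)
  also have "(\<Sum>i=2..n. (- 1 / sqrt (real n * (real n - 1))) ^ r)
      = (real n - 1) * ((- 1) ^ r / sqrt (real n * (real n - 1)) ^ r)"
    using n by (simp add: power_divide of_nat_diff flip: power_divide)
  finally show ?thesis by (simp add: power_divide add_divide_distrib)
qed

lemma power_sum_signed_permutation:
  assumes "\<pi> permutes {1..n}"
  shows "power_sum n r (\<lambda>i\<in>{1..n}. s * u (\<pi> i)) = s ^ r * power_sum n r u"
proof -
  have "power_sum n r (\<lambda>i\<in>{1..n}. s * u (\<pi> i)) = s ^ r * (\<Sum>i=1..n. u (\<pi> i) ^ r)"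
    by (simp add: power_sum_def power_mult_distrib sum_distrib_left)
  also have "(\<Sum>i=1..n. u (\<pi> i) ^ r) = power_sum n r u"
    using sum.permute[OF assms, of "\<lambda>i. u i ^ r"] by (simp add: power_sum_def o_def)
  finally show ?thesis .
qed

lemma single_outlier_direction:
  assumes n: "n \<ge> 3" and u: "u \<in> single_outlier_directions n"
  shows "u \<in> Omega n" "JB n u = real n / 24 * (((real n - 2)\<^sup>2 / (real n - 1))\<^sup>2 + 4)"
proof -
  from u obtain s \<pi> where u: "u = (\<lambda>i\<in>{1..n}. s * outlier n (\<pi> i))"
    and s: "s = 1 \<or> s = - 1" and p: "\<pi> permutes {1..n}"
    unfolding single_outlier_directions_def by blast
  \<comment> \<open>In terms of \<open>m = n - 1\<close> the moments become rational functions free of subtraction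
      in the denominators.\<close>
  define m where "m = real n - 1"
  define w where "w = sqrt ((m + 1) * m)"
  have m: "m \<ge> 2" "real n = m + 1" using n by (auto simp: m_def)
  have w2: "w\<^sup>2 = (m + 1) * m" using m by (simp add: w_def)
  have w4: "w ^ 4 = ((m + 1) * m)\<^sup>2" and w6: "w ^ 6 = ((m + 1) * m) ^ 3"
    unfolding w2[symmetric] by (simp_all flip: power_mult)
  have P: "power_sum n r u = s ^ r * ((m ^ r + m * (- 1) ^ r) / w ^ r)" if "r \<ge> 1" for r
    unfolding u power_sum_signed_permutation[OF p]
    using power_sum_outlier[of n r] n that by (simp add: w_def m)
  have s2: "s\<^sup>2 = 1" "s ^ 4 = 1" "(s ^ 3)\<^sup>2 = 1" using s by auto
  have p2: "power_sum n 2 u = 1"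
    using m by (simp add: P s2 w2 divide_simps) (simp add: power2_eq_square algebra_simps)
  moreover have "power_sum n 1 u = 0" by (simp add: P)
  ultimately show "u \<in> Omega n" by (simp add: Omega_def u)
  have p3: "(power_sum n 3 u)\<^sup>2 = (m ^ 3 - m)\<^sup>2 / ((m + 1) * m) ^ 3"
    unfolding w6[symmetric] P[of 3, simplified] power_mult_distrib[of "s ^ 3"] power_divide s2
    by simp
  have p4: "power_sum n 4 u = (m ^ 4 + m) / ((m + 1) * m)\<^sup>2"
    by (simp add: P s2 w4)
  have "(m + 1)\<^sup>2 * (power_sum n 3 u)\<^sup>2 = (m + 1) * ((m - 1)\<^sup>2 / m)"
    unfolding p3 using m
    by (simp add: divide_simps) (simp add: power2_eq_square power3_eq_cube algebra_simps)
  moreover have "(m + 1) * power_sum n 4 u - 3 = (m - 1)\<^sup>2 / m - 2"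
    unfolding p4 using m
    by (simp add: divide_simps) (simp add: power2_eq_square power4_eq_xxxx algebra_simps)
  ultimately have "JB n u = (m + 1) / 6 * ((m - 1)\<^sup>2 / m) + (m + 1) / 24 * ((m - 1)\<^sup>2 / m - 2)\<^sup>2"
    unfolding JB_power_sum m(2) by simp
  also have "c / 6 * b + c / 24 * (b - 2)\<^sup>2 = c / 24 * (b\<^sup>2 + 4)" for b c :: real
    by (simp add: power2_eq_square field_simps)
  finally show "JB n u = real n / 24 * (((real n - 2)\<^sup>2 / (real n - 1))\<^sup>2 + 4)"
    by (simp add: m)
qed

section \<open>The lower bound in low dimension\<close>

text \<open>
  The quantity \<open>q\<close> in the proof is the third elementary symmetric function of the squares.
  In general it equals \<open>e\<^sub>3\<^sup>2 - 2 e\<^sub>2 e\<^sub>4 + 2 e\<^sub>1 e\<^sub>5 - 2 e\<^sub>6\<close>; five variables have \<open>e\<^sub>6 = 0\<close>, and the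
  constraints say \<open>e\<^sub>1 = 0\<close> and \<open>e\<^sub>2 = -1/2\<close>. Three and four variables are covered by
  setting the remaining ones to 0.
\<close>

lemma five_reals_skewness_ge:
  fixes a b c d e :: real
  assumes s1: "a + b + c + d + e = 0" and s2: "a\<^sup>2 + b\<^sup>2 + c\<^sup>2 + d\<^sup>2 + e\<^sup>2 = 1"
  shows "9 / 4 * ((a ^ 4 + b ^ 4 + c ^ 4 + d ^ 4 + e ^ 4) - 1 / 2)
           \<le> (a ^ 3 + b ^ 3 + c ^ 3 + d ^ 3 + e ^ 3)\<^sup>2"
proof -
  define e3 where "e3 = a*b*c + a*b*d + a*b*e + a*c*d + a*c*e + a*d*e + b*c*d + b*c*e + b*d*e + c*d*e"
  define e4 where "e4 = a*b*c*d + a*b*c*e + a*b*d*e + a*c*d*e + b*c*d*e"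
  define q where "q = (a*b*c)\<^sup>2 + (a*b*d)\<^sup>2 + (a*b*e)\<^sup>2 + (a*c*d)\<^sup>2 + (a*c*e)\<^sup>2 + (a*d*e)\<^sup>2
    + (b*c*d)\<^sup>2 + (b*c*e)\<^sup>2 + (b*d*e)\<^sup>2 + (c*d*e)\<^sup>2"
  have a: "a = - (b + c + d + e)" using s1 by simp
  have "a ^ 3 + b ^ 3 + c ^ 3 + d ^ 3 + e ^ 3 = 3 * e3"
    unfolding e3_def a by algebra
  moreover have "2 * (a ^ 4 + b ^ 4 + c ^ 4 + d ^ 4 + e ^ 4) = (a\<^sup>2 + b\<^sup>2 + c\<^sup>2 + d\<^sup>2 + e\<^sup>2)\<^sup>2 - 8 * e4"
    unfolding e4_def a by algebra
  then have "a ^ 4 + b ^ 4 + c ^ 4 + d ^ 4 + e ^ 4 = 1 / 2 - 4 * e4" by (simp add: s2)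
  moreover have "q = e3\<^sup>2 + (a\<^sup>2 + b\<^sup>2 + c\<^sup>2 + d\<^sup>2 + e\<^sup>2) * e4"
    unfolding q_def e3_def e4_def a by algebra
  then have "q = e3\<^sup>2 + e4" by (simp add: s2)
  moreover have "q \<ge> 0" unfolding q_def by simp
  ultimately show ?thesis by (simp add: power_mult_distrib)
qed

lemma power_sum_skewness_ge:
  assumes n: "n \<in> {3, 4, 5}" and u: "u \<in> Omega n"
  shows "9 / 4 * (power_sum n 4 u - 1 / 2) \<le> (power_sum n 3 u)\<^sup>2"
proof -
  have "{1..3::nat} = {1, 2, 3}" "{1..4::nat} = {1, 2, 3, 4}" "{1..5::nat} = {1, 2, 3, 4, 5}" by auto
  then show ?thesis
    using n u five_reals_skewness_ge[of "u 1" "u 2" "u 3" 0 0]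
      five_reals_skewness_ge[of "u 1" "u 2" "u 3" "u 4" 0]
      five_reals_skewness_ge[of "u 1" "u 2" "u 3" "u 4" "u 5"]
    by (auto simp: Omega_def power_sum_def add.assoc)
qed

text \<open>
  With \<open>y = p\<^sub>4 - 1/2\<close>, the part of \<open>JB\<close> that is linear in \<open>y\<close> has the coefficient
  \<open>n\<^sup>2 (n - 6) / 24 < 0\<close>, so it helps when \<open>y \<le> 0\<close>; for \<open>y > 0\<close> it is outweighed by the
  skewness term, which is at least \<open>(n\<^sup>2 / 6) (9 / 4) y\<close>.
\<close>

lemma JB_ge:
  assumes n: "n \<in> {3, 4, 5}" and u: "u \<in> Omega n"
  shows "real n / 24 * (real n / 2 - 3)\<^sup>2 \<le> JB n u"
proof -
  define y where "y = power_sum n 4 u - 1 / 2"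
  define z where "z = (power_sum n 3 u)\<^sup>2"
  have yz: "9 / 4 * y \<le> z" "0 \<le> z"
    using power_sum_skewness_ge[OF assms] by (auto simp: y_def z_def)
  have n': "3 \<le> real n" "real n \<le> 6" using n by auto
  have "0 \<le> (real n - 6) * y + 4 * z"
  proof (cases "y \<ge> 0")
    case True
    then have "0 \<le> (real n - 6 + 9) * y" using n' by (intro mult_nonneg_nonneg) auto
    also have "\<dots> \<le> (real n - 6) * y + 4 * z" using yz by (simp add: algebra_simps)
    finally show ?thesis .
  next
    case False
    then have "0 \<le> (real n - 6) * y" using n' by (intro mult_nonpos_nonpos) auto
    then show ?thesis using yz by simp
  qed
  then have "0 \<le> (real n)\<^sup>2 / 24 * ((real n - 6) * y + 4 * z) + real n ^ 3 / 24 * y\<^sup>2"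
    by (simp add: zero_le_mult_iff)
  moreover have "JB n u = (real n)\<^sup>2 / 6 * z + real n / 24 * (real n * (y + 1 / 2) - 3)\<^sup>2"
    by (simp add: JB_power_sum y_def z_def)
  then have "JB n u = real n / 24 * (real n / 2 - 3)\<^sup>2
      + ((real n)\<^sup>2 / 24 * ((real n - 6) * y + 4 * z) + real n ^ 3 / 24 * y\<^sup>2)"
    by (simp add: power2_eq_square power3_eq_cube field_simps)
  ultimately show ?thesis by linarith
qed

section \<open>Symmetric configurations\<close>

text \<open>
  The entries come in pairs \<open>-\<surd>(g j), \<surd>(g j)\<close> for \<open>j < m\<close>, followed by zeros. The squares are
  prescribed rather than the entries because \<open>p\<^sub>2\<close> and \<open>p\<^sub>4\<close> then become a linear and a
  quadratic condition on \<open>g\<close>.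
\<close>

definition paired :: "nat \<Rightarrow> nat \<Rightarrow> (nat \<Rightarrow> real) \<Rightarrow> nat \<Rightarrow> real" where
  "paired n m g = (\<lambda>i\<in>{1..n}. if i \<le> 2 * m then (- 1) ^ i * sqrt (g ((i - 1) div 2)) else 0)"

lemma sum_pairs:
  fixes f :: "nat \<Rightarrow> real"
  shows "(\<Sum>i=1..2 * m. f i) = (\<Sum>j<m. f (2 * j + 1) + f (2 * j + 2))"
  by (induction m) simp_all

lemma power_sum_paired:
  assumes "2 * m \<le> n" "r \<ge> 1"
  shows "power_sum n r (paired n m g) = (1 + (- 1) ^ r) * (\<Sum>j<m. sqrt (g j) ^ r)"
proof -
  have "power_sum n r (paired n m g) = (\<Sum>i=1..2 * m. ((- 1) ^ i * sqrt (g ((i - 1) div 2))) ^ r)"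
    unfolding power_sum_def using assms
    by (intro sum.mono_neutral_cong_right) (auto simp: paired_def)
  also have "\<dots> = (\<Sum>j<m. (1 + (- 1) ^ r) * sqrt (g j) ^ r)"
    unfolding sum_pairs by (intro sum.cong refl) (simp add: power_minus' algebra_simps power_minus[of "sqrt _"])
  finally show ?thesis by (simp add: sum_distrib_left)
qed

lemma paired_configuration:
  assumes m: "2 * m \<le> n" and g: "\<And>j. 0 \<le> g j" and sg: "2 * (\<Sum>j<m. g j) = 1"
  shows "paired n m g \<in> Omega n"
    and "JB n (paired n m g) = real n / 24 * (real n * (2 * (\<Sum>j<m. (g j)\<^sup>2)) - 3)\<^sup>2"
proof -
  have "sqrt (g j) ^ 4 = (g j)\<^sup>2" for j
    using power_mult[of "sqrt (g j)" 2 2] g[of j] by simp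
  then show "paired n m g \<in> Omega n"
    "JB n (paired n m g) = real n / 24 * (real n * (2 * (\<Sum>j<m. (g j)\<^sup>2)) - 3)\<^sup>2"
    using g sg by (simp_all add: Omega_def JB_power_sum power_sum_paired[OF m])
      (simp add: paired_def)
qed

lemma JB_single_pair_attained:
  assumes "n \<ge> 2"
  obtains u where "u \<in> Omega n" "JB n u = real n / 24 * (real n / 2 - 3)\<^sup>2"
proof -
  define g :: "nat \<Rightarrow> real" where "g = (\<lambda>j. 1 / 2)"
  have "paired n 1 g \<in> Omega n" "JB n (paired n 1 g) = real n / 24 * (real n / 2 - 3)\<^sup>2"
    using paired_configuration[of 1 n g] assms by (auto simp: g_def power2_eq_square)
  then show ?thesis using that by blast
qed

text \<open>
  All \<open>m = k + 1\<close> available pairs are used, one with square \<open>1/(2m) + (m - 1) d\<close> and the others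
  with \<open>1/(2m) - d\<close>. This keeps \<open>p\<^sub>2 = 1\<close> and makes \<open>p\<^sub>4\<close> run from \<open>1/(2m)\<close> (all pairs
  equal) up to \<open>1/2\<close> (one pair only) as \<open>d\<close> goes from \<open>0\<close> to \<open>1/(2m)\<close>. The required value
  \<open>3/n\<close> lies in this range: below because \<open>n \<le> 2m + 1 \<le> 6m\<close>, above because \<open>n \<ge> 6\<close>.
\<close>

lemma JB_zero_attained:
  assumes n: "n \<ge> 6"
  obtains u where "u \<in> Omega n" "JB n u = 0"
proof -
  define k where "k = n div 2 - 1"
  define t where "t = real k"
  have k: "2 * (k + 1) \<le> n" "k \<ge> 2" "n \<le> 2 * (k + 1) + 1" using n by (auto simp: k_def)
  have t: "t \<ge> 2" "2 * (t + 1) \<le> real n" "real n \<le> 6 * (t + 1)" "real n \<ge> 6"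
    using k n by (auto simp: t_def)
  \<comment> \<open>Half of the excess of the required \<open>p\<^sub>4\<close> over its value for equal pairs.\<close>
  define v where "v = 3 / (2 * real n) - 1 / (4 * (t + 1))"
  have "3 / (2 * real n) \<le> 1 / 4" using t by (simp add: field_simps)
  also have "1 / 4 = t / (4 * (t + 1)) + 1 / (4 * (t + 1))" using t by (simp add: field_simps)
  finally have v: "v \<le> t / (4 * (t + 1))" unfolding v_def by linarith
  have "0 \<le> v" using t by (simp add: v_def field_simps)
  note v = this v
  define d where "d = sqrt (v / (t * (t + 1)))"
  have d2: "t * (t + 1) * d\<^sup>2 = v" using v t by (simp add: d_def)
  have d0: "d \<ge> 0" using v t by (simp add: d_def)
  have "v / (t * (t + 1)) \<le> (1 / (2 * (t + 1)))\<^sup>2"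
  proof -
    have "v / (t * (t + 1)) \<le> (t / (4 * (t + 1))) / (t * (t + 1))"
      using v t by (intro divide_right_mono) auto
    also have "\<dots> = (1 / (2 * (t + 1)))\<^sup>2"
      using t by (simp add: divide_simps) algebra
    finally show ?thesis .
  qed
  then have d1: "d \<le> 1 / (2 * (t + 1))"
    unfolding d_def using t by (intro real_le_lsqrt) auto
  define g :: "nat \<Rightarrow> real" where "g = (\<lambda>j. if j = 0 then 1 / (2 * (t + 1)) + t * d else 1 / (2 * (t + 1)) - d)"
  have g0: "0 \<le> g j" for j using d0 d1 t by (auto simp: g_def)
  have sum: "(\<Sum>j<k + 1. f (g j)) = f (1 / (2 * (t + 1)) + t * d) + t * f (1 / (2 * (t + 1)) - d)"
    for f :: "real \<Rightarrow> real"
    by (simp add: lessThan_Suc_eq_insert_0 sum.reindex g_def t_def)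
  have g1: "2 * (\<Sum>j<k + 1. g j) = 1"
    unfolding sum[of "\<lambda>z. z"] using t by (simp add: divide_simps) (simp add: algebra_simps)
  have "(\<Sum>j<k + 1. (g j)\<^sup>2) = 1 / (4 * (t + 1)) + t * (t + 1) * d\<^sup>2"
    unfolding sum[of "\<lambda>z. z\<^sup>2"] using t by (simp add: divide_simps) algebra
  also have "\<dots> = 3 / (2 * real n)" unfolding d2 v_def by simp
  finally have "real n * (2 * (\<Sum>j<k + 1. (g j)\<^sup>2)) = 3" using t by simp
  with paired_configuration[of "k + 1" n g, OF k(1) g0 g1] that show ?thesis by simp
qed

section \<open>The extreme values\<close>

lemma J_minus_eqI:
  assumes "u \<in> Omega n" "JB n u = y" "\<And>v. v \<in> Omega n \<Longrightarrow> y \<le> JB n v"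
  shows "J_minus n = y" "is_arg_min (JB n) (\<lambda>v. v \<in> Omega n) u"
proof -
  show "J_minus n = y"
    unfolding J_minus_def using assms by (intro Least_equality) auto
  show "is_arg_min (JB n) (\<lambda>v. v \<in> Omega n) u"
    using assms by (auto simp: is_arg_min_linorder)
qed

lemma J_plus_eqI:
  assumes "u \<in> Omega n" "JB n u = y" "\<And>v. v \<in> Omega n \<Longrightarrow> JB n v \<le> y"
  shows "J_plus n = y" "is_arg_max (JB n) (\<lambda>v. v \<in> Omega n) u"
proof -
  show "J_plus n = y"
    unfolding J_plus_def using assms by (intro Greatest_equality) auto
  show "is_arg_max (JB n) (\<lambda>v. v \<in> Omega n) u"
    using assms by (auto simp: is_arg_max_linorder)
qed

lemma J_minus_small:
  assumes n: "n \<in> {3, 4, 5}"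
  shows "J_minus n = real n / 24 * (real n / 2 - 3)\<^sup>2"
    and "\<exists>u. is_arg_min (JB n) (\<lambda>v. v \<in> Omega n) u \<and> JB n u = J_minus n"
proof -
  have "n \<ge> 2" using n by auto
  then obtain u where u: "u \<in> Omega n" "JB n u = real n / 24 * (real n / 2 - 3)\<^sup>2"
    by (rule JB_single_pair_attained)
  show J: "J_minus n = real n / 24 * (real n / 2 - 3)\<^sup>2"
    using J_minus_eqI[OF u] JB_ge[OF n] by blast
  show "\<exists>u. is_arg_min (JB n) (\<lambda>v. v \<in> Omega n) u \<and> JB n u = J_minus n"
    using J_minus_eqI(2)[OF u] JB_ge[OF n] u J by metis
qed

lemma J_minus_large:
  assumes n: "n \<ge> 6"
  shows "J_minus n = 0"
    and "\<exists>u. is_arg_min (JB n) (\<lambda>v. v \<in> Omega n) u \<and> JB n u = J_minus n"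
proof -
  obtain u where u: "u \<in> Omega n" "JB n u = 0"
    using JB_zero_attained[OF n] .
  have ge: "0 \<le> JB n v" for v by (simp add: JB_def)
  show J: "J_minus n = 0"
    using J_minus_eqI[OF u] ge by blast
  show "\<exists>u. is_arg_min (JB n) (\<lambda>v. v \<in> Omega n) u \<and> JB n u = J_minus n"
    using J_minus_eqI(2)[OF u] ge u J by metis
qed

lemma J_plus_eq:
  assumes n: "n \<ge> 3"
  shows "J_plus n = real n / 24 * (((real n - 2)\<^sup>2 / (real n - 1))\<^sup>2 + 4)"
    and "\<exists>u. is_arg_max (JB n) (\<lambda>v. v \<in> Omega n) u \<and> JB n u = J_plus n"
proof -
  have "(\<lambda>i\<in>{1..n}. 1 * outlier n (id i)) \<in> single_outlier_directions n"
    unfolding single_outlier_directions_def using permutes_id by blast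
  then obtain u where "u \<in> single_outlier_directions n" by blast
  note u = single_outlier_direction[OF n this]
  show J: "J_plus n = real n / 24 * (((real n - 2)\<^sup>2 / (real n - 1))\<^sup>2 + 4)"
    using J_plus_eqI[OF u] JB_le[OF n] by blast
  show "\<exists>u. is_arg_max (JB n) (\<lambda>v. v \<in> Omega n) u \<and> JB n u = J_plus n"
    using J_plus_eqI(2)[OF u] JB_le[OF n] u J by metis
qed

theorem theorem1:
  "(\<forall>n\<ge>3.
      (\<exists>u. is_arg_min (JB n) (\<lambda>v. v \<in> Omega n) u \<and> JB n u = J_minus n) \<and>
      (\<exists>u. is_arg_max (JB n) (\<lambda>v. v \<in> Omega n) u \<and> JB n u = J_plus n) \<and>
      J_plus n = real n / 24 * (A_n n ^ 4 + 4) \<and>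
      J_plus n = real n * ((real n - 2) ^ 4 + 4 * (real n - 1)\<^sup>2) / (24 * (real n - 1)\<^sup>2) \<and>
      (\<forall>u \<in> single_outlier_directions n. u \<in> Omega n \<and> JB n u = J_plus n)) \<and>
   J_minus 3 = 9 / 32 \<and>
   J_minus 4 = 1 / 6 \<and>
   J_minus 5 = 5 / 96 \<and>
   (\<forall>n\<ge>6. J_minus n = 0)"
proof (intro conjI allI impI ballI)
  fix n :: nat assume n: "n \<ge> 3"
  have "n \<in> {3, 4, 5} \<or> n \<ge> 6" using n by auto
  then show "\<exists>u. is_arg_min (JB n) (\<lambda>v. v \<in> Omega n) u \<and> JB n u = J_minus n"
    using J_minus_small(2) J_minus_large(2) by blast
  show "\<exists>u. is_arg_max (JB n) (\<lambda>v. v \<in> Omega n) u \<and> JB n u = J_plus n"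
    by (rule J_plus_eq(2)[OF n])
  have "(A_n n)\<^sup>2 = (real n - 2)\<^sup>2 / (real n - 1)"
    using n by (simp add: A_n_def power_divide)
  then have "A_n n ^ 4 = ((real n - 2)\<^sup>2 / (real n - 1))\<^sup>2"
    by (metis mult_2 numeral_Bit0 power_mult power2_eq_square power_even_eq)
  then show "J_plus n = real n / 24 * (A_n n ^ 4 + 4)"
    using J_plus_eq(1)[OF n] by simp
  show "J_plus n = real n * ((real n - 2) ^ 4 + 4 * (real n - 1)\<^sup>2) / (24 * (real n - 1)\<^sup>2)"
    unfolding J_plus_eq(1)[OF n] using n by (simp add: field_simps)
  fix u assume "u \<in> single_outlier_directions n"
  from single_outlier_direction[OF n this] J_plus_eq(1)[OF n]
  show "u \<in> Omega n" "JB n u = J_plus n" by simp_all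
next
  show "J_minus 3 = 9 / 32" "J_minus 4 = 1 / 6" "J_minus 5 = 5 / 96"
    using J_minus_small(1)[of 3] J_minus_small(1)[of 4] J_minus_small(1)[of 5]
    by (simp_all add: power2_eq_square)
  show "J_minus n = 0" if "n \<ge> 6" for n
    using that by (rule J_minus_large(1))
qed

end
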